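(* Let $s \colon S \rightarrowtail I$ be a subunit in a braided monoidal category $\mathbf{C}$. Then $\mathbf{C}|_s$ is a coreflective monoidal subcategory of $\mathbf{C}$: the inclusion $\mathbf{C}|_s \hookrightarrow \mathbf{C}$ has a right adjoint $\mathbf{C} \to \mathbf{C}|_s$, given by $A \mapsto S \otimes A$ on objects and $f \mapsto S \otimes f$ on morphisms.
   Context: An object name also denotes its identity morphism, so $s \otimes A$ means $s \otimes \mathrm{id}_A$. A subunit in a braided monoidal category $\mathbf{C}$ with tensor unit $I$ is a subobject $s \colon S \rightarrowtail I$ (equivalence class of monomorphisms, identified when they factor through each other) such that $s \otimes S \colon S \otimes S \to I \otimes S$ is an isomorphism. The restriction $\mathbf{C}|_s$ of $\mathbf{C}$ to $s$ is the full subcategory of $\mathbf{C}$ of those objects $A$ for which $s \otimes A \colon S \otimes A \to I \otimes A$ is an isomorphism. It is regarded as a monoidal category with tensor product inherited from $\mathbf{C}$ and with tensor unit $S$ (so "monoidal subcategory" does not mean that it contains $I$). *)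

theory Defs
  imports Main
begin

section \<open>Categories\<close>

text \<open>Composition is written in applicative order: \<open>g \<cdot> f\<close> is "\<open>f\<close>, then \<open>g\<close>".
  All operations are total functions that are only specified on the carriers.\<close>

record ('o, 'a) cat =
  Obj :: "'o set"
  Arr :: "'a set"
  Dom :: "'a \<Rightarrow> 'o"
  Cod :: "'a \<Rightarrow> 'o"
  Id :: "'o \<Rightarrow> 'a"
  Comp :: "'a \<Rightarrow> 'a \<Rightarrow> 'a"  (infixr "\<cdot>\<index>" 65)

definition Hom :: "('o, 'a, 'z) cat_scheme \<Rightarrow> 'o \<Rightarrow> 'o \<Rightarrow> 'a set" where
  "Hom C A B = {f \<in> Arr C. Dom C f = A \<and> Cod C f = B}"

locale category =
  fixes C :: "('o, 'a, 'z) cat_scheme" (structure)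
  assumes Dom_in_Obj: "f \<in> Arr C \<Longrightarrow> Dom C f \<in> Obj C"
    and Cod_in_Obj: "f \<in> Arr C \<Longrightarrow> Cod C f \<in> Obj C"
    and Id_in_Hom: "A \<in> Obj C \<Longrightarrow> Id C A \<in> Hom C A A"
    and Comp_in_Hom: "f \<in> Hom C A B \<Longrightarrow> g \<in> Hom C B D \<Longrightarrow> g \<cdot> f \<in> Hom C A D"
    and Comp_Id_left: "f \<in> Hom C A B \<Longrightarrow> Id C B \<cdot> f = f"
    and Comp_Id_right: "f \<in> Hom C A B \<Longrightarrow> f \<cdot> Id C A = f"
    and Comp_assoc: "f \<in> Hom C A B \<Longrightarrow> g \<in> Hom C B D \<Longrightarrow> h \<in> Hom C D E \<Longrightarrow>
           (h \<cdot> g) \<cdot> f = h \<cdot> (g \<cdot> f)"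

definition inverse_arrows :: "('o, 'a, 'z) cat_scheme \<Rightarrow> 'a \<Rightarrow> 'a \<Rightarrow> bool" where
  "inverse_arrows C f g \<longleftrightarrow>
     f \<in> Arr C \<and> g \<in> Hom C (Cod C f) (Dom C f) \<and>
     g \<cdot>\<^bsub>C\<^esub> f = Id C (Dom C f) \<and> f \<cdot>\<^bsub>C\<^esub> g = Id C (Cod C f)"

definition iso_arrow :: "('o, 'a, 'z) cat_scheme \<Rightarrow> 'a \<Rightarrow> bool" where
  "iso_arrow C f \<longleftrightarrow> (\<exists>g. inverse_arrows C f g)"

definition inv_arrow :: "('o, 'a, 'z) cat_scheme \<Rightarrow> 'a \<Rightarrow> 'a" where
  "inv_arrow C f = (THE g. inverse_arrows C f g)"

definition mono_arrow :: "('o, 'a, 'z) cat_scheme \<Rightarrow> 'a \<Rightarrow> bool" where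
  "mono_arrow C f \<longleftrightarrow> f \<in> Arr C \<and>
     (\<forall>A g h. g \<in> Hom C A (Dom C f) \<longrightarrow> h \<in> Hom C A (Dom C f) \<longrightarrow>
        f \<cdot>\<^bsub>C\<^esub> g = f \<cdot>\<^bsub>C\<^esub> h \<longrightarrow> g = h)"


section \<open>Subobjects\<close>

definition monos_into :: "('o, 'a, 'z) cat_scheme \<Rightarrow> 'o \<Rightarrow> 'a set" where
  "monos_into C X = {s. mono_arrow C s \<and> Cod C s = X}"

definition factors_through :: "('o, 'a, 'z) cat_scheme \<Rightarrow> 'a \<Rightarrow> 'a \<Rightarrow> bool" where
  "factors_through C s t \<longleftrightarrow> (\<exists>m \<in> Hom C (Dom C s) (Dom C t). s = t \<cdot>\<^bsub>C\<^esub> m)"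

definition subobject_rel :: "('o, 'a, 'z) cat_scheme \<Rightarrow> 'o \<Rightarrow> ('a \<times> 'a) set" where
  "subobject_rel C X = {(s, t). s \<in> monos_into C X \<and> t \<in> monos_into C X \<and>
     factors_through C s t \<and> factors_through C t s}"

definition subobjects :: "('o, 'a, 'z) cat_scheme \<Rightarrow> 'o \<Rightarrow> 'a set set" where
  "subobjects C X = monos_into C X // subobject_rel C X"


section \<open>Functors, subcategories and adjunctions\<close>

locale cat_functor = C: category C + D: category D
  for C :: "('o, 'a, 'z) cat_scheme" and D :: "('p, 'b, 'y) cat_scheme" +
  fixes Fo :: "'o \<Rightarrow> 'p" and Fa :: "'a \<Rightarrow> 'b"
  assumes Fo_in_Obj: "A \<in> Obj C \<Longrightarrow> Fo A \<in> Obj D"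
    and Fa_in_Hom: "f \<in> Hom C A B \<Longrightarrow> Fa f \<in> Hom D (Fo A) (Fo B)"
    and Fa_Id: "A \<in> Obj C \<Longrightarrow> Fa (Id C A) = Id D (Fo A)"
    and Fa_Comp: "f \<in> Hom C A B \<Longrightarrow> g \<in> Hom C B E \<Longrightarrow>
           Fa (g \<cdot>\<^bsub>C\<^esub> f) = Fa g \<cdot>\<^bsub>D\<^esub> Fa f"

text \<open>\<open>G : D \<rightarrow> C\<close> is right adjoint to \<open>F : C \<rightarrow> D\<close>: there is a bijection
  \<open>D(F A, B) \<cong> C(A, G B)\<close>, natural in \<open>A\<close> and \<open>B\<close>.\<close>

definition right_adjoint ::
  "('o, 'a, 'z) cat_scheme \<Rightarrow> ('p, 'b, 'y) cat_scheme \<Rightarrow>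
   ('o \<Rightarrow> 'p) \<Rightarrow> ('a \<Rightarrow> 'b) \<Rightarrow> ('p \<Rightarrow> 'o) \<Rightarrow> ('b \<Rightarrow> 'a) \<Rightarrow> bool" where
  "right_adjoint C D Fo Fa Go Ga \<longleftrightarrow>
     cat_functor C D Fo Fa \<and> cat_functor D C Go Ga \<and>
     (\<exists>\<phi> :: 'o \<Rightarrow> 'p \<Rightarrow> 'b \<Rightarrow> 'a.
        (\<forall>A \<in> Obj C. \<forall>B \<in> Obj D. bij_betw (\<phi> A B) (Hom D (Fo A) B) (Hom C A (Go B))) \<and>
        (\<forall>A \<in> Obj C. \<forall>A' \<in> Obj C. \<forall>B \<in> Obj D. \<forall>B' \<in> Obj D.
           \<forall>f \<in> Hom C A' A. \<forall>g \<in> Hom D B B'. \<forall>h \<in> Hom D (Fo A) B.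
             \<phi> A' B' (g \<cdot>\<^bsub>D\<^esub> h \<cdot>\<^bsub>D\<^esub> Fa f) = Ga g \<cdot>\<^bsub>C\<^esub> \<phi> A B h \<cdot>\<^bsub>C\<^esub> f))"

locale subcategory = D: category D + C: category C
  for D :: "('o, 'a, 'y) cat_scheme" and C :: "('o, 'a, 'z) cat_scheme" +
  assumes Obj_subset: "Obj D \<subseteq> Obj C"
    and Arr_subset: "Arr D \<subseteq> Arr C"
    and Dom_eq: "f \<in> Arr D \<Longrightarrow> Dom D f = Dom C f"
    and Cod_eq: "f \<in> Arr D \<Longrightarrow> Cod D f = Cod C f"
    and Id_eq: "A \<in> Obj D \<Longrightarrow> Id D A = Id C A"
    and Comp_eq: "f \<in> Hom D A B \<Longrightarrow> g \<in> Hom D B E \<Longrightarrow> g \<cdot>\<^bsub>D\<^esub> f = g \<cdot>\<^bsub>C\<^esub> f"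


section \<open>Monoidal and braided monoidal categories\<close>

record ('o, 'a) mon_cat = "('o, 'a) cat" +
  TensO :: "'o \<Rightarrow> 'o \<Rightarrow> 'o"  (infixr "\<otimes>\<index>" 70)
  TensA :: "'a \<Rightarrow> 'a \<Rightarrow> 'a"  (infixr "\<odot>\<index>" 70)
  Unit :: "'o"  ("\<one>\<index>")
  Assoc :: "'o \<Rightarrow> 'o \<Rightarrow> 'o \<Rightarrow> 'a"
  LUnit :: "'o \<Rightarrow> 'a"
  RUnit :: "'o \<Rightarrow> 'a"

text \<open>Tensor products of objects and of arrows are distinguished as \<open>\<otimes>\<close> and \<open>\<odot>\<close>.\<close>

locale monoidal_category = category C
  for C :: "('o, 'a, 'z) mon_cat_scheme" (structure) +
  assumes TensO_in_Obj: "A \<in> Obj C \<Longrightarrow> B \<in> Obj C \<Longrightarrow> A \<otimes> B \<in> Obj C"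
    and TensA_in_Hom: "f \<in> Hom C A A' \<Longrightarrow> g \<in> Hom C B B' \<Longrightarrow>
           f \<odot> g \<in> Hom C (A \<otimes> B) (A' \<otimes> B')"
    and TensA_Id: "A \<in> Obj C \<Longrightarrow> B \<in> Obj C \<Longrightarrow> Id C A \<odot> Id C B = Id C (A \<otimes> B)"
    and TensA_Comp:
      "f \<in> Hom C A A' \<Longrightarrow> f' \<in> Hom C A' A'' \<Longrightarrow> g \<in> Hom C B B' \<Longrightarrow> g' \<in> Hom C B' B'' \<Longrightarrow>
         (f' \<cdot> f) \<odot> (g' \<cdot> g) = (f' \<odot> g') \<cdot> (f \<odot> g)"
    and Unit_in_Obj: "\<one> \<in> Obj C"
    and Assoc_in_Hom: "A \<in> Obj C \<Longrightarrow> B \<in> Obj C \<Longrightarrow> D \<in> Obj C \<Longrightarrow>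
           Assoc C A B D \<in> Hom C ((A \<otimes> B) \<otimes> D) (A \<otimes> (B \<otimes> D))"
    and Assoc_iso: "A \<in> Obj C \<Longrightarrow> B \<in> Obj C \<Longrightarrow> D \<in> Obj C \<Longrightarrow> iso_arrow C (Assoc C A B D)"
    and Assoc_natural: "f \<in> Hom C A A' \<Longrightarrow> g \<in> Hom C B B' \<Longrightarrow> h \<in> Hom C D D' \<Longrightarrow>
           Assoc C A' B' D' \<cdot> ((f \<odot> g) \<odot> h) = (f \<odot> (g \<odot> h)) \<cdot> Assoc C A B D"
    and LUnit_in_Hom: "A \<in> Obj C \<Longrightarrow> LUnit C A \<in> Hom C (\<one> \<otimes> A) A"
    and LUnit_iso: "A \<in> Obj C \<Longrightarrow> iso_arrow C (LUnit C A)"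
    and LUnit_natural: "f \<in> Hom C A B \<Longrightarrow> LUnit C B \<cdot> (Id C \<one> \<odot> f) = f \<cdot> LUnit C A"
    and RUnit_in_Hom: "A \<in> Obj C \<Longrightarrow> RUnit C A \<in> Hom C (A \<otimes> \<one>) A"
    and RUnit_iso: "A \<in> Obj C \<Longrightarrow> iso_arrow C (RUnit C A)"
    and RUnit_natural: "f \<in> Hom C A B \<Longrightarrow> RUnit C B \<cdot> (f \<odot> Id C \<one>) = f \<cdot> RUnit C A"
    and triangle: "A \<in> Obj C \<Longrightarrow> B \<in> Obj C \<Longrightarrow>
           (Id C A \<odot> LUnit C B) \<cdot> Assoc C A \<one> B = RUnit C A \<odot> Id C B"
    and pentagon: "A \<in> Obj C \<Longrightarrow> B \<in> Obj C \<Longrightarrow> D \<in> Obj C \<Longrightarrow> E \<in> Obj C \<Longrightarrow>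
           Assoc C A B (D \<otimes> E) \<cdot> Assoc C (A \<otimes> B) D E =
           (Id C A \<odot> Assoc C B D E) \<cdot> Assoc C A (B \<otimes> D) E \<cdot> (Assoc C A B D \<odot> Id C E)"

record ('o, 'a) braided_cat = "('o, 'a) mon_cat" +
  Braid :: "'o \<Rightarrow> 'o \<Rightarrow> 'a"

locale braided_monoidal_category = monoidal_category C
  for C :: "('o, 'a, 'z) braided_cat_scheme" (structure) +
  assumes Braid_in_Hom: "A \<in> Obj C \<Longrightarrow> B \<in> Obj C \<Longrightarrow> Braid C A B \<in> Hom C (A \<otimes> B) (B \<otimes> A)"
    and Braid_iso: "A \<in> Obj C \<Longrightarrow> B \<in> Obj C \<Longrightarrow> iso_arrow C (Braid C A B)"
    and Braid_natural: "f \<in> Hom C A A' \<Longrightarrow> g \<in> Hom C B B' \<Longrightarrow>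
           Braid C A' B' \<cdot> (f \<odot> g) = (g \<odot> f) \<cdot> Braid C A B"
    and hexagon1: "A \<in> Obj C \<Longrightarrow> B \<in> Obj C \<Longrightarrow> D \<in> Obj C \<Longrightarrow>
           Assoc C B D A \<cdot> Braid C A (B \<otimes> D) \<cdot> Assoc C A B D =
           (Id C B \<odot> Braid C A D) \<cdot> Assoc C B A D \<cdot> (Braid C A B \<odot> Id C D)"
    and hexagon2: "A \<in> Obj C \<Longrightarrow> B \<in> Obj C \<Longrightarrow> D \<in> Obj C \<Longrightarrow>
           inv_arrow C (Assoc C D A B) \<cdot> Braid C (A \<otimes> B) D \<cdot> inv_arrow C (Assoc C A B D) =
           (Braid C A D \<odot> Id C B) \<cdot> inv_arrow C (Assoc C A D B) \<cdot> (Id C A \<odot> Braid C B D)"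

text \<open>The tensor product and associator of a monoidal subcategory are those of the ambient
  category, but its tensor unit and unitors may be different ones.\<close>

locale monoidal_subcategory = subcategory D C + D: monoidal_category D + C: monoidal_category C
  for D :: "('o, 'a, 'y) mon_cat_scheme" and C :: "('o, 'a, 'z) mon_cat_scheme" +
  assumes TensO_eq: "A \<in> Obj D \<Longrightarrow> B \<in> Obj D \<Longrightarrow> A \<otimes>\<^bsub>D\<^esub> B = A \<otimes>\<^bsub>C\<^esub> B"
    and TensA_eq: "f \<in> Arr D \<Longrightarrow> g \<in> Arr D \<Longrightarrow> f \<odot>\<^bsub>D\<^esub> g = f \<odot>\<^bsub>C\<^esub> g"
    and Assoc_eq: "A \<in> Obj D \<Longrightarrow> B \<in> Obj D \<Longrightarrow> E \<in> Obj D \<Longrightarrow> Assoc D A B E = Assoc C A B E"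


section \<open>Subunits and restriction\<close>

text \<open>The condition does not depend on the representative \<open>s\<close> of the subobject \<open>\<sigma>\<close>:
  two representatives differ by an isomorphism of their domains.\<close>

definition subunit :: "('o, 'a, 'z) mon_cat_scheme \<Rightarrow> 'a set \<Rightarrow> bool" where
  "subunit C \<sigma> \<longleftrightarrow> \<sigma> \<in> subobjects C \<one>\<^bsub>C\<^esub> \<and>
     (\<exists>s \<in> \<sigma>. iso_arrow C (s \<odot>\<^bsub>C\<^esub> Id C (Dom C s)))"

definition restriction_obj :: "('o, 'a, 'z) mon_cat_scheme \<Rightarrow> 'a \<Rightarrow> 'o set" where
  "restriction_obj C s = {A \<in> Obj C. iso_arrow C (s \<odot>\<^bsub>C\<^esub> Id C A)}"

text \<open>The full subcategory on \<^term>\<open>restriction_obj C s\<close>, with tensor unit the domain \<open>S\<close> of \<open>s\<close>.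
  The unitors are the composites \<open>S \<otimes> A \<rightarrow> I \<otimes> A \<rightarrow> A\<close> and \<open>A \<otimes> S \<rightarrow> A \<otimes> I \<rightarrow> A\<close> of
  \<open>s \<otimes> A\<close> and \<open>A \<otimes> s\<close> with the unitors of \<open>C\<close>; everything else is inherited.\<close>

definition restriction ::
  "('o, 'a, 'z) mon_cat_scheme \<Rightarrow> 'a \<Rightarrow> ('o, 'a, 'z) mon_cat_scheme" where
  "restriction C s = C
     \<lparr>Obj := restriction_obj C s,
      Arr := {f \<in> Arr C. Dom C f \<in> restriction_obj C s \<and> Cod C f \<in> restriction_obj C s},
      Unit := Dom C s,
      LUnit := (\<lambda>A. LUnit C A \<cdot>\<^bsub>C\<^esub> (s \<odot>\<^bsub>C\<^esub> Id C A)),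
      RUnit := (\<lambda>A. RUnit C A \<cdot>\<^bsub>C\<^esub> (Id C A \<odot>\<^bsub>C\<^esub> s))\<rparr>"

end

theory Submission
  imports Defs
begin

text \<open>Write \<open>\<epsilon>\<^sub>A : S \<otimes> A \<rightarrow> A\<close> for \<open>s \<otimes> A\<close> followed by the left unitor. It is natural in \<open>A\<close>, and it is
  invertible exactly when \<open>A\<close> lies in the restriction.

  The associator identifies \<open>(s \<otimes> A) \<otimes> B\<close> with \<open>s \<otimes> (A \<otimes> B)\<close>, so \<open>A \<otimes> B\<close> lies in the restriction
  as soon as \<open>A\<close> does. This makes the restriction closed under tensor products, and since \<open>S\<close> lies in
  it, by the definition of a subunit and its independence of the representative
  (\<open>subunit_representative\<close>), so does every \<open>S \<otimes> A\<close>. The map \<open>\<epsilon>\<^sub>A\<close> is the left unitor of the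
  restriction; the braiding identifies \<open>s \<otimes> A\<close> with \<open>A \<otimes> s\<close>, so the right unitor is invertible too.
  The triangle law follows from that of \<open>C\<close> and the naturality of the associator, and the remaining
  coherence is inherited.

  The unit of the adjunction is \<open>\<epsilon>\<^sub>A\<close> inverted, for \<open>A\<close> in the restriction, so \<open>h : A \<rightarrow> B\<close>
  corresponds to \<open>S \<otimes> h\<close> preceded by this inverse. Composition with the counit \<open>\<epsilon>\<^sub>B\<close> takes this back
  to \<open>h\<close>, by naturality. For the other triangle identity it suffices that composition with \<open>\<epsilon>\<^sub>B\<close> is
  injective on arrows \<open>k : A \<rightarrow> S \<otimes> B\<close> with \<open>A\<close> in the restriction (\<open>counit_cancel\<close>). Here \<open>\<epsilon>\<^sub>B\<close> need not be monic, but
  \<open>S \<otimes> \<epsilon>\<^sub>B\<close> is invertible, because \<open>S \<otimes> s\<close> is; so \<open>\<epsilon>\<^sub>B \<cdot> k\<close> determines \<open>S \<otimes> k\<close>, and that determines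
  \<open>k\<close> because \<open>\<epsilon>\<^sub>A\<close> is invertible. This argument replaces a proof from the coherence laws that
  \<open>S \<otimes> \<epsilon>\<^sub>B\<close> equals \<open>\<epsilon>\<close> at \<open>S \<otimes> B\<close>.\<close>

section \<open>Isomorphisms\<close>

context category
begin

lemma Hom_Obj: "f \<in> Hom C A B \<Longrightarrow> A \<in> Obj C" "f \<in> Hom C A B \<Longrightarrow> B \<in> Obj C"
  using Dom_in_Obj Cod_in_Obj by (auto simp: Hom_def)

lemma iso_arrowI:
  "f \<in> Hom C A B \<Longrightarrow> g \<in> Hom C B A \<Longrightarrow> g \<cdot> f = Id C A \<Longrightarrow> f \<cdot> g = Id C B \<Longrightarrow> iso_arrow C f"
  by (auto simp: iso_arrow_def inverse_arrows_def Hom_def)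

lemma iso_arrowE:
  assumes "iso_arrow C f" "f \<in> Hom C A B"
  obtains g where "g \<in> Hom C B A" "g \<cdot> f = Id C A" "f \<cdot> g = Id C B"
  using assms by (auto simp: iso_arrow_def inverse_arrows_def Hom_def)

lemma inverse_arrows_unique:
  assumes "inverse_arrows C f g" "inverse_arrows C f h"
  shows "g = h"
proof -
  let ?A = "Dom C f" and ?B = "Cod C f"
  have f: "f \<in> Hom C ?A ?B" and g: "g \<in> Hom C ?B ?A" and h: "h \<in> Hom C ?B ?A"
    using assms by (auto simp: inverse_arrows_def Hom_def)
  have "g = g \<cdot> (f \<cdot> h)"
    using assms(2) Comp_Id_right[OF g] by (simp add: inverse_arrows_def)
  also have "\<dots> = (g \<cdot> f) \<cdot> h"
    using Comp_assoc[OF h f g] by simp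
  also have "\<dots> = h"
    using assms(1) Comp_Id_left[OF h] by (simp add: inverse_arrows_def)
  finally show ?thesis .
qed

lemma inv_arrow_props:
  assumes "iso_arrow C f" "f \<in> Hom C A B"
  shows "inv_arrow C f \<in> Hom C B A" "inv_arrow C f \<cdot> f = Id C A" "f \<cdot> inv_arrow C f = Id C B"
proof -
  obtain g where g: "inverse_arrows C f g"
    using assms(1) by (auto simp: iso_arrow_def)
  have "inverse_arrows C f (inv_arrow C f)"
    unfolding inv_arrow_def by (rule theI[of _ g]) (auto intro: g inverse_arrows_unique)
  then show "inv_arrow C f \<in> Hom C B A" "inv_arrow C f \<cdot> f = Id C A" "f \<cdot> inv_arrow C f = Id C B"
    using assms(2) by (auto simp: inverse_arrows_def Hom_def)
qed

lemma inv_arrow_cancel_left: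
  assumes "iso_arrow C f" "f \<in> Hom C A B" "g \<in> Hom C D A"
  shows "inv_arrow C f \<cdot> (f \<cdot> g) = g"
  using Comp_assoc[OF assms(3,2) inv_arrow_props(1)[OF assms(1,2)]]
    inv_arrow_props(2)[OF assms(1,2)] Comp_Id_left[OF assms(3)]
  by simp

lemma inv_arrow_cancel_right:
  assumes "iso_arrow C f" "f \<in> Hom C A B" "g \<in> Hom C B D"
  shows "(g \<cdot> f) \<cdot> inv_arrow C f = g"
  using Comp_assoc[OF inv_arrow_props(1)[OF assms(1,2)] assms(2,3)]
    inv_arrow_props(3)[OF assms(1,2)] Comp_Id_right[OF assms(3)]
  by simp

lemma iso_arrow_left_cancel:
  assumes "iso_arrow C f" "f \<in> Hom C A B" "g \<in> Hom C D A" "h \<in> Hom C D A" "f \<cdot> g = f \<cdot> h"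
  shows "g = h"
proof -
  have "g = inv_arrow C f \<cdot> (f \<cdot> g)"
    by (rule inv_arrow_cancel_left[OF assms(1-3), symmetric])
  also have "\<dots> = h"
    unfolding assms(5) by (rule inv_arrow_cancel_left[OF assms(1,2,4)])
  finally show ?thesis .
qed

lemma iso_arrow_right_cancel:
  assumes "iso_arrow C f" "f \<in> Hom C A B" "g \<in> Hom C B D" "h \<in> Hom C B D" "g \<cdot> f = h \<cdot> f"
  shows "g = h"
proof -
  have "g = (g \<cdot> f) \<cdot> inv_arrow C f"
    by (rule inv_arrow_cancel_right[OF assms(1-3), symmetric])
  also have "\<dots> = h"
    unfolding assms(5) by (rule inv_arrow_cancel_right[OF assms(1,2,4)])
  finally show ?thesis .
qed

lemma iso_arrow_Comp:
  assumes f: "f \<in> Hom C A B" "iso_arrow C f" and g: "g \<in> Hom C B D" "iso_arrow C g"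
  shows "iso_arrow C (g \<cdot> f)"
proof -
  obtain f' where f': "f' \<in> Hom C B A" "f' \<cdot> f = Id C A" "f \<cdot> f' = Id C B"
    using f by (metis iso_arrowE)
  obtain g' where g': "g' \<in> Hom C D B" "g' \<cdot> g = Id C B" "g \<cdot> g' = Id C D"
    using g by (metis iso_arrowE)
  have gf: "g \<cdot> f \<in> Hom C A D" and fg': "f' \<cdot> g' \<in> Hom C D A"
    using f g f' g' Comp_in_Hom by blast+
  have "(f' \<cdot> g') \<cdot> (g \<cdot> f) = f' \<cdot> ((g' \<cdot> g) \<cdot> f)"
    using Comp_assoc[OF gf g'(1) f'(1)] Comp_assoc[OF f(1) g(1) g'(1)] by simp
  then have 1: "(f' \<cdot> g') \<cdot> (g \<cdot> f) = Id C A"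
    using f' g' f Comp_Id_left by simp
  have "(g \<cdot> f) \<cdot> (f' \<cdot> g') = g \<cdot> ((f \<cdot> f') \<cdot> g')"
    using Comp_assoc[OF fg' f(1) g(1)] Comp_assoc[OF g'(1) f'(1) f(1)] by simp
  then have 2: "(g \<cdot> f) \<cdot> (f' \<cdot> g') = Id C D"
    using f' g' g Comp_Id_left by simp
  show ?thesis
    by (rule iso_arrowI[OF gf fg' 1 2])
qed

lemma iso_arrow_inv:
  assumes "f \<in> Hom C A B" "iso_arrow C f"
  shows "iso_arrow C (inv_arrow C f)"
  using inv_arrow_props[OF assms(2,1)] assms(1) iso_arrowI by blast

lemma iso_arrow_of_Comp_left:
  assumes f: "f \<in> Hom C A B" and g: "g \<in> Hom C B D" "iso_arrow C g" and gf: "iso_arrow C (g \<cdot> f)"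
  shows "iso_arrow C f"
  using iso_arrow_Comp[OF Comp_in_Hom[OF f g(1)] gf inv_arrow_props(1)[OF g(2,1)]
      iso_arrow_inv[OF g]] inv_arrow_cancel_left[OF g(2,1) f]
  by simp

lemma iso_arrow_of_Comp_right:
  assumes f: "f \<in> Hom C A B" "iso_arrow C f" and g: "g \<in> Hom C B D" and gf: "iso_arrow C (g \<cdot> f)"
  shows "iso_arrow C g"
  using iso_arrow_Comp[OF inv_arrow_props(1)[OF f(2,1)] iso_arrow_inv[OF f]
      Comp_in_Hom[OF f(1) g] gf] inv_arrow_cancel_right[OF f(2,1) g]
  by simp

lemma iso_arrow_square:
  assumes "f \<in> Hom C A B" "f' \<in> Hom C A' B'"
    and p: "p \<in> Hom C A A'" "iso_arrow C p" and q: "q \<in> Hom C B B'" "iso_arrow C q"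
    and sq: "q \<cdot> f = f' \<cdot> p"
  shows "iso_arrow C f \<longleftrightarrow> iso_arrow C f'"
proof
  assume "iso_arrow C f"
  then show "iso_arrow C f'"
    using iso_arrow_of_Comp_right[OF p assms(2)] iso_arrow_Comp[OF assms(1) _ q] sq by simp
next
  assume "iso_arrow C f'"
  then show "iso_arrow C f"
    using iso_arrow_of_Comp_left[OF assms(1) q] iso_arrow_Comp[OF p assms(2)] sq by simp
qed

text \<open>Equivalent monomorphisms factor through each other, and being monic makes the two mediating
  arrows inverse to each other. Membership in a common class only relates \<open>s\<close> and \<open>t\<close> through a third
  representative \<open>x\<close>, so the mediating arrows are composites.\<close>

lemma subobject_representatives_iso:
  assumes "\<sigma> \<in> subobjects C X" "s \<in> \<sigma>" "t \<in> \<sigma>"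
  obtains m where "m \<in> Hom C (Dom C s) (Dom C t)" "iso_arrow C m" "s = t \<cdot> m"
proof -
  obtain x where x: "(x, s) \<in> subobject_rel C X" "(x, t) \<in> subobject_rel C X"
    using assms by (auto simp: subobjects_def quotient_def)
  then have s: "mono_arrow C s" "s \<in> Hom C (Dom C s) X"
    and t: "mono_arrow C t" "t \<in> Hom C (Dom C t) X"
    by (auto simp: subobject_rel_def monos_into_def mono_arrow_def Hom_def)
  obtain a b c d where
    a: "a \<in> Hom C (Dom C x) (Dom C s)" "x = s \<cdot> a" and
    b: "b \<in> Hom C (Dom C s) (Dom C x)" "s = x \<cdot> b" and
    c: "c \<in> Hom C (Dom C x) (Dom C t)" "x = t \<cdot> c" and
    d: "d \<in> Hom C (Dom C t) (Dom C x)" "t = x \<cdot> d"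
    using x unfolding subobject_rel_def factors_through_def by blast
  define m n where "m = c \<cdot> b" and "n = a \<cdot> d"
  have m: "m \<in> Hom C (Dom C s) (Dom C t)" and n: "n \<in> Hom C (Dom C t) (Dom C s)"
    using a b c d Comp_in_Hom m_def n_def by blast+
  have sm: "s = t \<cdot> m"
    using Comp_assoc[OF b(1) c(1) t(2)] b(2) c(2) m_def by simp
  have tn: "t = s \<cdot> n"
    using Comp_assoc[OF d(1) a(1) s(2)] a(2) d(2) n_def by simp
  have "s \<cdot> (n \<cdot> m) = s \<cdot> Id C (Dom C s)"
    using Comp_assoc[OF m n s(2)] Comp_Id_right[OF s(2)] by (simp flip: sm tn)
  then have nm: "n \<cdot> m = Id C (Dom C s)"
    using s(1) Comp_in_Hom[OF m n] Id_in_Hom Hom_Obj[OF m] unfolding mono_arrow_def by blast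
  have "t \<cdot> (m \<cdot> n) = t \<cdot> Id C (Dom C t)"
    using Comp_assoc[OF n m t(2)] Comp_Id_right[OF t(2)] by (simp flip: sm tn)
  then have mn: "m \<cdot> n = Id C (Dom C t)"
    using t(1) Comp_in_Hom[OF n m] Id_in_Hom Hom_Obj[OF n] unfolding mono_arrow_def by blast
  show thesis
    by (rule that[OF m iso_arrowI[OF m n nm mn] sm])
qed

end

context monoidal_category
begin

lemma Id_TensA_Comp:
  "A \<in> Obj C \<Longrightarrow> f \<in> Hom C B D \<Longrightarrow> g \<in> Hom C D E \<Longrightarrow>
    Id C A \<odot> (g \<cdot> f) = (Id C A \<odot> g) \<cdot> (Id C A \<odot> f)"
  using TensA_Comp[of "Id C A" A A "Id C A" A f B D g E] Id_in_Hom[of A] Comp_Id_left[of "Id C A" A A]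
  by simp

lemma TensA_Id_Comp:
  "A \<in> Obj C \<Longrightarrow> f \<in> Hom C B D \<Longrightarrow> g \<in> Hom C D E \<Longrightarrow>
    (g \<cdot> f) \<odot> Id C A = (g \<odot> Id C A) \<cdot> (f \<odot> Id C A)"
  using TensA_Comp[of f B D g E "Id C A" A A "Id C A" A] Id_in_Hom[of A] Comp_Id_left[of "Id C A" A A]
  by simp

lemma TensA_interchange:
  assumes f: "f \<in> Hom C A A'" and g: "g \<in> Hom C B B'"
  shows "(f \<odot> Id C B') \<cdot> (Id C A \<odot> g) = (Id C A' \<odot> g) \<cdot> (f \<odot> Id C B)"
  using TensA_Comp[OF Id_in_Hom f g Id_in_Hom] TensA_Comp[OF f Id_in_Hom Id_in_Hom g]
    Hom_Obj[OF f] Hom_Obj[OF g] Comp_Id_left[OF f] Comp_Id_right[OF f]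
    Comp_Id_left[OF g] Comp_Id_right[OF g]
  by simp

lemma iso_arrow_Id: "A \<in> Obj C \<Longrightarrow> iso_arrow C (Id C A)"
  using iso_arrowI Id_in_Hom Comp_Id_left by metis

lemma iso_arrow_TensA:
  assumes f: "f \<in> Hom C A A'" "iso_arrow C f" and g: "g \<in> Hom C B B'" "iso_arrow C g"
  shows "iso_arrow C (f \<odot> g)"
proof -
  obtain f' where f': "f' \<in> Hom C A' A" "f' \<cdot> f = Id C A" "f \<cdot> f' = Id C A'"
    using f by (metis iso_arrowE)
  obtain g' where g': "g' \<in> Hom C B' B" "g' \<cdot> g = Id C B" "g \<cdot> g' = Id C B'"
    using g by (metis iso_arrowE)
  have "(f' \<odot> g') \<cdot> (f \<odot> g) = Id C (A \<otimes> B)" "(f \<odot> g) \<cdot> (f' \<odot> g') = Id C (A' \<otimes> B')"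
    using TensA_Comp[OF f(1) f'(1) g(1) g'(1)] TensA_Comp[OF f'(1) f(1) g'(1) g(1)]
      f' g' TensA_Id Hom_Obj[OF f(1)] Hom_Obj[OF g(1)] by simp_all
  then show ?thesis
    using iso_arrowI TensA_in_Hom f(1) f'(1) g(1) g'(1) by metis
qed

section \<open>Subunits and their representatives\<close>

text \<open>If \<open>s = t \<cdot> m\<close> with \<open>m\<close> invertible, then \<open>s \<otimes> S\<close> differs from \<open>t \<otimes> S\<close> by \<open>m \<otimes> S\<close>, and
  \<open>t \<otimes> S\<close> differs from \<open>t \<otimes> T\<close> by \<open>m\<close> in the second factor.\<close>

lemma subunit_representative:
  assumes "subunit C \<sigma>" "s \<in> \<sigma>"
  shows "s \<in> Hom C (Dom C s) \<one>" "iso_arrow C (s \<odot> Id C (Dom C s))"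
proof -
  have \<sigma>: "\<sigma> \<in> subobjects C \<one>"
    using assms(1) by (simp add: subunit_def)
  obtain t where t: "t \<in> \<sigma>" "iso_arrow C (t \<odot> Id C (Dom C t))"
    using assms(1) by (auto simp: subunit_def)
  have Hom: "r \<in> Hom C (Dom C r) \<one>" if "r \<in> \<sigma>" for r
    using \<sigma> that
    by (auto simp: subobjects_def quotient_def subobject_rel_def monos_into_def mono_arrow_def Hom_def)
  show "s \<in> Hom C (Dom C s) \<one>"
    using Hom assms(2) by blast
  note tT = Hom[OF t(1)]
  obtain m where m: "m \<in> Hom C (Dom C s) (Dom C t)" "iso_arrow C m" "s = t \<cdot> m"
    using subobject_representatives_iso[OF \<sigma> assms(2) t(1)] .
  note obj = Hom_Obj[OF m(1)]
  have "iso_arrow C (t \<odot> Id C (Dom C s))"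
    using iso_arrow_square[OF
        TensA_in_Hom[OF tT Id_in_Hom[OF obj(1)]] TensA_in_Hom[OF tT Id_in_Hom[OF obj(2)]]
        TensA_in_Hom[OF Id_in_Hom[OF obj(2)] m(1)]
        iso_arrow_TensA[OF Id_in_Hom[OF obj(2)] iso_arrow_Id[OF obj(2)] m(1,2)]
        TensA_in_Hom[OF Id_in_Hom[OF Unit_in_Obj] m(1)]
        iso_arrow_TensA[OF Id_in_Hom[OF Unit_in_Obj] iso_arrow_Id[OF Unit_in_Obj] m(1,2)]
        TensA_interchange[OF tT m(1), symmetric]] t(2)
    by simp
  then have "iso_arrow C ((t \<odot> Id C (Dom C s)) \<cdot> (m \<odot> Id C (Dom C s)))"
    using iso_arrow_Comp TensA_in_Hom iso_arrow_TensA iso_arrow_Id Id_in_Hom m(1,2) tT obj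
    by metis
  then show "iso_arrow C (s \<odot> Id C (Dom C s))"
    using TensA_Id_Comp[OF obj(1) m(1) tT] m(3) by simp
qed

end

text \<open>By \<open>subunit_representative\<close>, every representative of a subunit satisfies these assumptions.\<close>

locale subunit_arrow = braided_monoidal_category C
  for C :: "('o, 'a, 'z) braided_cat_scheme" (structure) +
  fixes s :: 'a and S :: 'o
  assumes s_in_Hom: "s \<in> Hom C S \<one>"
    and s_S_iso: "iso_arrow C (s \<odot> Id C S)"
begin

abbreviation R :: "('o, 'a, ('o, 'a, 'z) braided_cat_ext) mon_cat_scheme" where
  "R \<equiv> restriction C s"

lemma Dom_s: "Dom C s = S"
  using s_in_Hom by (simp add: Hom_def)

lemma S_in_Obj: "S \<in> Obj C"
  using Hom_Obj s_in_Hom by blast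

lemma restriction_simps:
  "Obj R = {A \<in> Obj C. iso_arrow C (s \<odot> Id C A)}"
  "Dom R = Dom C" "Cod R = Cod C" "Id R = Id C" "Comp R = Comp C"
  "TensO R = TensO C" "TensA R = TensA C" "Assoc R = Assoc C" "Unit R = S"
  "LUnit R A = LUnit C A \<cdot> (s \<odot> Id C A)" "RUnit R A = RUnit C A \<cdot> (Id C A \<odot> s)"
  by (simp_all add: restriction_def restriction_obj_def Dom_s)

lemma Arr_restriction: "f \<in> Arr R \<longleftrightarrow> f \<in> Arr C \<and> Dom C f \<in> Obj R \<and> Cod C f \<in> Obj R"
  by (simp add: restriction_def)

lemma Obj_restriction: "A \<in> Obj R \<longleftrightarrow> A \<in> Obj C \<and> iso_arrow C (s \<odot> Id C A)"
  by (simp add: restriction_simps)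

lemma Hom_restriction: "f \<in> Hom R A B \<longleftrightarrow> f \<in> Hom C A B \<and> A \<in> Obj R \<and> B \<in> Obj R"
  by (auto simp: Hom_def Arr_restriction restriction_simps(2,3))

lemma iso_arrow_restriction:
  assumes "f \<in> Hom R A B"
  shows "iso_arrow R f \<longleftrightarrow> iso_arrow C f"
proof -
  have "inverse_arrows R f g \<longleftrightarrow> inverse_arrows C f g" for g
    using assms by (auto simp: inverse_arrows_def Hom_def Arr_restriction restriction_simps(2-5))
  then show ?thesis
    by (simp add: iso_arrow_def)
qed

section \<open>The counit and the objects of the restriction\<close>

definition counit :: "'o \<Rightarrow> 'a" where
  "counit A = LUnit C A \<cdot> (s \<odot> Id C A)"

lemma s_TensA_in_Hom: "A \<in> Obj C \<Longrightarrow> s \<odot> Id C A \<in> Hom C (S \<otimes> A) (\<one> \<otimes> A)"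
  using TensA_in_Hom s_in_Hom Id_in_Hom by blast

lemma TensA_s_in_Hom: "A \<in> Obj C \<Longrightarrow> Id C A \<odot> s \<in> Hom C (A \<otimes> S) (A \<otimes> \<one>)"
  using TensA_in_Hom s_in_Hom Id_in_Hom by blast

lemma counit_in_Hom: "A \<in> Obj C \<Longrightarrow> counit A \<in> Hom C (S \<otimes> A) A"
  unfolding counit_def using Comp_in_Hom s_TensA_in_Hom LUnit_in_Hom by blast

lemma counit_iso: "A \<in> Obj R \<Longrightarrow> iso_arrow C (counit A)"
  unfolding counit_def Obj_restriction
  using iso_arrow_Comp s_TensA_in_Hom LUnit_in_Hom LUnit_iso by blast

lemma S_TensA_in_Hom: "f \<in> Hom C A B \<Longrightarrow> Id C S \<odot> f \<in> Hom C (S \<otimes> A) (S \<otimes> B)"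
  using TensA_in_Hom Id_in_Hom S_in_Obj by blast

lemma counit_natural:
  assumes f: "f \<in> Hom C A B"
  shows "counit B \<cdot> (Id C S \<odot> f) = f \<cdot> counit A"
proof -
  note obj = Hom_Obj[OF f]
  note If = TensA_in_Hom[OF Id_in_Hom[OF Unit_in_Obj] f]
  have "counit B \<cdot> (Id C S \<odot> f) = LUnit C B \<cdot> ((s \<odot> Id C B) \<cdot> (Id C S \<odot> f))"
    unfolding counit_def
    using Comp_assoc[OF S_TensA_in_Hom[OF f] s_TensA_in_Hom LUnit_in_Hom] obj by simp
  also have "\<dots> = LUnit C B \<cdot> ((Id C \<one> \<odot> f) \<cdot> (s \<odot> Id C A))"
    using TensA_interchange[OF s_in_Hom f] by simp
  also have "\<dots> = (LUnit C B \<cdot> (Id C \<one> \<odot> f)) \<cdot> (s \<odot> Id C A)"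
    using Comp_assoc[OF s_TensA_in_Hom If LUnit_in_Hom] obj by simp
  also have "\<dots> = f \<cdot> counit A"
    unfolding counit_def LUnit_natural[OF f]
    using Comp_assoc[OF s_TensA_in_Hom LUnit_in_Hom f] obj by simp
  finally show ?thesis .
qed

text \<open>The associator identifies \<open>s \<otimes> (A \<otimes> B)\<close> with \<open>(s \<otimes> A) \<otimes> B\<close>. Since \<open>B\<close> is arbitrary, this serves
  both for closure under tensor products and for \<open>S \<otimes> B\<close>.\<close>

lemma TensO_in_restriction:
  assumes A: "A \<in> Obj R" and B: "B \<in> Obj C"
  shows "A \<otimes> B \<in> Obj R"
proof -
  have A': "A \<in> Obj C" and AB: "A \<otimes> B \<in> Obj C"
    using A B TensO_in_Obj by (auto simp: Obj_restriction)
  have "iso_arrow C ((s \<odot> Id C A) \<odot> Id C B)"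
    using A B iso_arrow_TensA[OF s_TensA_in_Hom _ Id_in_Hom iso_arrow_Id]
    by (simp add: Obj_restriction)
  moreover have "Assoc C \<one> A B \<cdot> ((s \<odot> Id C A) \<odot> Id C B) = (s \<odot> Id C (A \<otimes> B)) \<cdot> Assoc C S A B"
    using Assoc_natural[OF s_in_Hom Id_in_Hom Id_in_Hom] A' B TensA_Id by simp
  ultimately have "iso_arrow C (s \<odot> Id C (A \<otimes> B))"
    using iso_arrow_square[OF TensA_in_Hom[OF s_TensA_in_Hom Id_in_Hom] s_TensA_in_Hom
        Assoc_in_Hom Assoc_iso Assoc_in_Hom Assoc_iso] A' B AB S_in_Obj Unit_in_Obj
    by simp
  then show ?thesis
    using AB by (simp add: Obj_restriction)
qed

lemma S_in_restriction: "S \<in> Obj R"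
  using S_in_Obj s_S_iso by (simp add: Obj_restriction)

text \<open>The naturality square of the braiding at \<open>s\<close> identifies \<open>A \<otimes> s\<close> with \<open>s \<otimes> A\<close>.\<close>

lemma TensA_s_iso:
  assumes A: "A \<in> Obj R"
  shows "iso_arrow C (Id C A \<odot> s)"
proof -
  have A': "A \<in> Obj C" "iso_arrow C (s \<odot> Id C A)"
    using A by (auto simp: Obj_restriction)
  have "Braid C \<one> A \<cdot> (s \<odot> Id C A) = (Id C A \<odot> s) \<cdot> Braid C S A"
    using Braid_natural[OF s_in_Hom Id_in_Hom] A' by simp
  then show ?thesis
    using iso_arrow_square[OF s_TensA_in_Hom TensA_s_in_Hom Braid_in_Hom Braid_iso Braid_in_Hom
        Braid_iso] A' S_in_Obj Unit_in_Obj
    by simp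
qed

section \<open>The monoidal structure on the restriction\<close>

lemma category_restriction: "category R"
proof
  show "Dom R f \<in> Obj R" "Cod R f \<in> Obj R" if "f \<in> Arr R" for f
    using that by (auto simp: Arr_restriction restriction_simps(2,3))
next
  fix f g h A B D E
  show "Id R A \<in> Hom R A A" if "A \<in> Obj R"
    using that Id_in_Hom by (simp add: Hom_restriction restriction_simps(4) Obj_restriction)
  assume f: "f \<in> Hom R A B"
  then show "Id R B \<cdot>\<^bsub>R\<^esub> f = f" "f \<cdot>\<^bsub>R\<^esub> Id R A = f"
    using Comp_Id_left Comp_Id_right by (auto simp: Hom_restriction restriction_simps(4,5))
  assume g: "g \<in> Hom R B D"
  then show "g \<cdot>\<^bsub>R\<^esub> f \<in> Hom R A D"
    using f Comp_in_Hom by (auto simp: Hom_restriction restriction_simps(5))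
  assume "h \<in> Hom R D E"
  then show "(h \<cdot>\<^bsub>R\<^esub> g) \<cdot>\<^bsub>R\<^esub> f = h \<cdot>\<^bsub>R\<^esub> (g \<cdot>\<^bsub>R\<^esub> f)"
    using f g Comp_assoc by (auto simp: Hom_restriction restriction_simps(5))
qed

lemma LUnit_restriction: "LUnit R A = counit A"
  by (simp add: restriction_simps counit_def)

lemma RUnit_restriction_in_Hom: "A \<in> Obj C \<Longrightarrow> RUnit R A \<in> Hom C (A \<otimes> S) A"
  unfolding restriction_simps using Comp_in_Hom TensA_s_in_Hom RUnit_in_Hom by blast

lemma RUnit_restriction_iso: "A \<in> Obj R \<Longrightarrow> iso_arrow C (RUnit R A)"
  unfolding restriction_simps(11)
  using iso_arrow_Comp[OF TensA_s_in_Hom TensA_s_iso RUnit_in_Hom RUnit_iso]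
  by (simp add: Obj_restriction)

lemma RUnit_restriction_natural:
  assumes f: "f \<in> Hom C A B"
  shows "RUnit R B \<cdot> (f \<odot> Id C S) = f \<cdot> RUnit R A"
proof -
  note obj = Hom_Obj[OF f]
  note fS = TensA_in_Hom[OF f Id_in_Hom[OF S_in_Obj]]
  note fI = TensA_in_Hom[OF f Id_in_Hom[OF Unit_in_Obj]]
  have "RUnit R B \<cdot> (f \<odot> Id C S) = RUnit C B \<cdot> ((Id C B \<odot> s) \<cdot> (f \<odot> Id C S))"
    unfolding restriction_simps using Comp_assoc[OF fS TensA_s_in_Hom RUnit_in_Hom] obj by simp
  also have "\<dots> = RUnit C B \<cdot> ((f \<odot> Id C \<one>) \<cdot> (Id C A \<odot> s))"
    using TensA_interchange[OF f s_in_Hom] by simp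
  also have "\<dots> = (RUnit C B \<cdot> (f \<odot> Id C \<one>)) \<cdot> (Id C A \<odot> s)"
    using Comp_assoc[OF TensA_s_in_Hom fI RUnit_in_Hom] obj by simp
  also have "\<dots> = f \<cdot> RUnit R A"
    unfolding RUnit_natural[OF f] restriction_simps
    using Comp_assoc[OF TensA_s_in_Hom RUnit_in_Hom f] obj by simp
  finally show ?thesis .
qed

text \<open>Naturality of the associator slides \<open>s\<close> from the middle factor on one side to the middle factor
  on the other, which reduces the triangle at \<open>S\<close> to the triangle at \<open>I\<close>.\<close>

lemma triangle_restriction:
  assumes A: "A \<in> Obj C" and B: "B \<in> Obj C"
  shows "(Id C A \<odot> counit B) \<cdot> Assoc C A S B = RUnit R A \<odot> Id C B"
proof -
  note \<alpha> = Assoc_in_Hom[OF A S_in_Obj B] Assoc_in_Hom[OF A Unit_in_Obj B]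
  note AsB = TensA_in_Hom[OF Id_in_Hom[OF A] s_TensA_in_Hom[OF B]]
  note AsB' = TensA_in_Hom[OF TensA_s_in_Hom[OF A] Id_in_Hom[OF B]]
  note Al = TensA_in_Hom[OF Id_in_Hom[OF A] LUnit_in_Hom[OF B]]
  have "(Id C A \<odot> counit B) \<cdot> Assoc C A S B
      = ((Id C A \<odot> LUnit C B) \<cdot> (Id C A \<odot> (s \<odot> Id C B))) \<cdot> Assoc C A S B"
    unfolding counit_def
    using Id_TensA_Comp[OF A s_TensA_in_Hom[OF B] LUnit_in_Hom[OF B]] by simp
  also have "\<dots> = (Id C A \<odot> LUnit C B) \<cdot> ((Id C A \<odot> (s \<odot> Id C B)) \<cdot> Assoc C A S B)"
    using Comp_assoc[OF \<alpha>(1) AsB Al] .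
  also have "\<dots> = (Id C A \<odot> LUnit C B) \<cdot> (Assoc C A \<one> B \<cdot> ((Id C A \<odot> s) \<odot> Id C B))"
    using Assoc_natural[OF Id_in_Hom[OF A] s_in_Hom Id_in_Hom[OF B]] by simp
  also have "\<dots> = ((Id C A \<odot> LUnit C B) \<cdot> Assoc C A \<one> B) \<cdot> ((Id C A \<odot> s) \<odot> Id C B)"
    using Comp_assoc[OF AsB' \<alpha>(2) Al] by simp
  also have "\<dots> = RUnit R A \<odot> Id C B"
    unfolding triangle[OF A B] restriction_simps
    using TensA_Id_Comp[OF B TensA_s_in_Hom[OF A] RUnit_in_Hom[OF A]] by simp
  finally show ?thesis .
qed

lemma monoidal_restriction: "monoidal_category R"
proof -
  interpret R: category R
    by (rule category_restriction)
  have sub: "A \<in> Obj C" if "A \<in> Obj R" for A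
    using that by (simp add: Obj_restriction)
  have tens: "A \<otimes> B \<in> Obj R" if "A \<in> Obj R" "B \<in> Obj R" for A B
    using that sub TensO_in_restriction by blast
  have assoc: "Assoc C A B D \<in> Hom R ((A \<otimes> B) \<otimes> D) (A \<otimes> (B \<otimes> D))"
    if "A \<in> Obj R" "B \<in> Obj R" "D \<in> Obj R" for A B D
    using that sub tens Assoc_in_Hom by (simp add: Hom_restriction)
  have lunit: "counit A \<in> Hom R (S \<otimes> A) A" if "A \<in> Obj R" for A
    using that sub tens S_in_restriction counit_in_Hom by (simp add: Hom_restriction)
  have runit: "RUnit R A \<in> Hom R (A \<otimes> S) A" if "A \<in> Obj R" for A
    using that sub tens S_in_restriction RUnit_restriction_in_Hom by (simp add: Hom_restriction)
  note simps = restriction_simps(2-9) LUnit_restriction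
  show ?thesis
  proof (unfold_locales, unfold simps)
    fix A B assume AB: "A \<in> Obj R" "B \<in> Obj R"
    show "A \<otimes> B \<in> Obj R"
      using AB tens by blast
    show "Id C A \<odot> Id C B = Id C (A \<otimes> B)"
      using AB sub TensA_Id by blast
    show "(Id C A \<odot> counit B) \<cdot> Assoc C A S B = RUnit R A \<odot> Id C B"
      using AB sub triangle_restriction by blast
  next
    fix f g A A' B B' assume "f \<in> Hom R A A'" "g \<in> Hom R B B'"
    then show "f \<odot> g \<in> Hom R (A \<otimes> B) (A' \<otimes> B')"
      using tens TensA_in_Hom by (simp add: Hom_restriction)
  next
    fix f f' g g' A A' A'' B B' B''
    assume "f \<in> Hom R A A'" "f' \<in> Hom R A' A''" "g \<in> Hom R B B'" "g' \<in> Hom R B' B''"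
    then show "(f' \<cdot> f) \<odot> (g' \<cdot> g) = (f' \<odot> g') \<cdot> (f \<odot> g)"
      using TensA_Comp by (auto simp: Hom_restriction)
  next
    show "S \<in> Obj R"
      by (rule S_in_restriction)
  next
    fix A B D assume ABD: "A \<in> Obj R" "B \<in> Obj R" "D \<in> Obj R"
    then show "Assoc C A B D \<in> Hom R ((A \<otimes> B) \<otimes> D) (A \<otimes> (B \<otimes> D))"
      by (rule assoc)
    show "iso_arrow R (Assoc C A B D)"
      using iso_arrow_restriction[OF assoc[OF ABD]] Assoc_iso ABD sub by blast
    fix E assume "E \<in> Obj R"
    then show "Assoc C A B (D \<otimes> E) \<cdot> Assoc C (A \<otimes> B) D E =
        (Id C A \<odot> Assoc C B D E) \<cdot> Assoc C A (B \<otimes> D) E \<cdot> (Assoc C A B D \<odot> Id C E)"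
      using pentagon ABD sub by blast
  next
    fix f g h A A' B B' D D' assume "f \<in> Hom R A A'" "g \<in> Hom R B B'" "h \<in> Hom R D D'"
    then show "Assoc C A' B' D' \<cdot> ((f \<odot> g) \<odot> h) = (f \<odot> (g \<odot> h)) \<cdot> Assoc C A B D"
      using Assoc_natural by (simp add: Hom_restriction)
  next
    fix A assume A: "A \<in> Obj R"
    show "counit A \<in> Hom R (S \<otimes> A) A" "RUnit R A \<in> Hom R (A \<otimes> S) A"
      using A lunit runit by blast+
    show "iso_arrow R (counit A)" "iso_arrow R (RUnit R A)"
      using iso_arrow_restriction lunit[OF A] runit[OF A] counit_iso[OF A] RUnit_restriction_iso[OF A]
      by blast+
  next
    fix f A B assume "f \<in> Hom R A B"
    then show "counit B \<cdot> (Id C S \<odot> f) = f \<cdot> counit A" "RUnit R B \<cdot> (f \<odot> Id C S) = f \<cdot> RUnit R A"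
      using counit_natural RUnit_restriction_natural by (auto simp: Hom_restriction)
  qed
qed

lemma monoidal_subcategory_restriction: "monoidal_subcategory R C"
proof -
  interpret R: monoidal_category R
    by (rule monoidal_restriction)
  show ?thesis
    by unfold_locales (auto simp: restriction_simps(2-8) Obj_restriction Arr_restriction)
qed

section \<open>The adjunction\<close>

text \<open>The triangle identifies \<open>S \<otimes> \<epsilon>\<^sub>B\<close> with \<open>\<rho>\<^sub>S \<otimes> B\<close>, where \<open>\<rho>\<close> is the right unitor of the
  restriction, and \<open>\<rho>\<^sub>S\<close> is invertible because \<open>S\<close> lies in the restriction.\<close>

lemma S_TensA_counit_iso:
  assumes B: "B \<in> Obj C"
  shows "iso_arrow C (Id C S \<odot> counit B)"
proof -
  note \<alpha> = Assoc_in_Hom[OF S_in_Obj S_in_Obj B]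
  note r = RUnit_restriction_in_Hom[OF S_in_Obj]
  have "iso_arrow C (RUnit R S \<odot> Id C B)"
    using iso_arrow_TensA[OF r RUnit_restriction_iso[OF S_in_restriction] Id_in_Hom iso_arrow_Id] B
    by blast
  then show ?thesis
    using iso_arrow_of_Comp_right[OF \<alpha> Assoc_iso S_TensA_in_Hom[OF counit_in_Hom[OF B]]]
      triangle_restriction[OF S_in_Obj B] S_in_Obj B
    by simp
qed

text \<open>Naturality of the counit recovers \<open>k \<cdot> \<epsilon>\<^sub>A\<close> from \<open>S \<otimes> k\<close>.\<close>

lemma S_TensA_faithful:
  assumes A: "A \<in> Obj R" and k: "k \<in> Hom C A B" and l: "l \<in> Hom C A B"
    and eq: "Id C S \<odot> k = Id C S \<odot> l"
  shows "k = l"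
proof -
  have "k \<cdot> counit A = l \<cdot> counit A"
    using counit_natural[OF k] counit_natural[OF l] eq by simp
  then show ?thesis
    using iso_arrow_right_cancel[OF counit_iso[OF A] counit_in_Hom k l] A
    by (simp add: Obj_restriction)
qed

text \<open>Although \<open>\<epsilon>\<^sub>B\<close> need not be monic, it can be cancelled here, because tensoring with \<open>S\<close> makes it
  invertible and loses no information about arrows out of \<open>A\<close>.\<close>

lemma counit_cancel:
  assumes A: "A \<in> Obj R" and B: "B \<in> Obj C"
    and k: "k \<in> Hom C A (S \<otimes> B)" and l: "l \<in> Hom C A (S \<otimes> B)"
    and eq: "counit B \<cdot> k = counit B \<cdot> l"
  shows "k = l"
proof -
  have "(Id C S \<odot> counit B) \<cdot> (Id C S \<odot> k) = (Id C S \<odot> counit B) \<cdot> (Id C S \<odot> l)"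
    using Id_TensA_Comp[OF S_in_Obj k counit_in_Hom[OF B]]
      Id_TensA_Comp[OF S_in_Obj l counit_in_Hom[OF B]] eq by simp
  then have "Id C S \<odot> k = Id C S \<odot> l"
    using iso_arrow_left_cancel[OF S_TensA_counit_iso[OF B] S_TensA_in_Hom[OF counit_in_Hom[OF B]]
        S_TensA_in_Hom[OF k] S_TensA_in_Hom[OF l]] by blast
  then show ?thesis
    by (rule S_TensA_faithful[OF A k l])
qed

text \<open>The transpose of \<open>h : A \<rightarrow> B\<close> under the adjunction, for \<open>A\<close> in the restriction.\<close>

definition adjunct :: "'o \<Rightarrow> 'o \<Rightarrow> 'a \<Rightarrow> 'a" where
  "adjunct A B h = (Id C S \<odot> h) \<cdot> inv_arrow C (counit A)"

lemma inv_counit: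
  assumes "A \<in> Obj R"
  shows "inv_arrow C (counit A) \<in> Hom C A (S \<otimes> A)" "counit A \<cdot> inv_arrow C (counit A) = Id C A"
  using inv_arrow_props[OF counit_iso[OF assms] counit_in_Hom] assms by (auto simp: Obj_restriction)

lemma adjunct_in_Hom:
  "A \<in> Obj R \<Longrightarrow> h \<in> Hom C A B \<Longrightarrow> adjunct A B h \<in> Hom C A (S \<otimes> B)"
  unfolding adjunct_def using Comp_in_Hom inv_counit(1) S_TensA_in_Hom by blast

lemma counit_adjunct:
  assumes A: "A \<in> Obj R" and h: "h \<in> Hom C A B"
  shows "counit B \<cdot> adjunct A B h = h"
proof -
  note obj = Hom_Obj[OF h]
  have "counit B \<cdot> adjunct A B h = (counit B \<cdot> (Id C S \<odot> h)) \<cdot> inv_arrow C (counit A)"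
    unfolding adjunct_def
    using Comp_assoc[OF inv_counit(1)[OF A] S_TensA_in_Hom[OF h] counit_in_Hom] obj by simp
  also have "\<dots> = h \<cdot> (counit A \<cdot> inv_arrow C (counit A))"
    unfolding counit_natural[OF h]
    using Comp_assoc[OF inv_counit(1)[OF A] counit_in_Hom h] obj by simp
  also have "\<dots> = h"
    using inv_counit(2)[OF A] Comp_Id_right[OF h] by simp
  finally show ?thesis .
qed

lemma adjunct_bij:
  assumes A: "A \<in> Obj R" and B: "B \<in> Obj C"
  shows "bij_betw (adjunct A B) (Hom C A B) (Hom R A (S \<otimes> B))"
proof (rule bij_betw_byWitness[where f' = "\<lambda>k. counit B \<cdot> k"])
  have Hom: "Hom R A (S \<otimes> B) = Hom C A (S \<otimes> B)"
    using A B TensO_in_restriction S_in_restriction by (auto simp: Hom_restriction)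
  show "\<forall>h \<in> Hom C A B. counit B \<cdot> adjunct A B h = h"
    using counit_adjunct[OF A] by blast
  show "adjunct A B ` Hom C A B \<subseteq> Hom R A (S \<otimes> B)"
    unfolding Hom using adjunct_in_Hom[OF A] by blast
  show counit_into: "(\<lambda>k. counit B \<cdot> k) ` Hom R A (S \<otimes> B) \<subseteq> Hom C A B"
    unfolding Hom using Comp_in_Hom counit_in_Hom[OF B] by blast
  show "\<forall>k \<in> Hom R A (S \<otimes> B). adjunct A B (counit B \<cdot> k) = k"
  proof
    fix k assume k: "k \<in> Hom R A (S \<otimes> B)"
    then have "counit B \<cdot> k \<in> Hom C A B"
      using counit_into by blast
    then show "adjunct A B (counit B \<cdot> k) = k"
      using counit_cancel[OF A B adjunct_in_Hom[OF A]] counit_adjunct[OF A] k Hom by simp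
  qed
qed

text \<open>Both sides have the same composite with the counit, and \<open>counit_cancel\<close> applies.\<close>

lemma adjunct_natural:
  assumes A: "A \<in> Obj R" and A': "A' \<in> Obj R"
    and f: "f \<in> Hom C A' A" and h: "h \<in> Hom C A B" and g: "g \<in> Hom C B B'"
  shows "adjunct A' B' (g \<cdot> h \<cdot> f) = (Id C S \<odot> g) \<cdot> adjunct A B h \<cdot> f"
proof (rule counit_cancel[OF A' Hom_Obj(2)[OF g]])
  note hf = Comp_in_Hom[OF f h]
  note ghf = Comp_in_Hom[OF hf g]
  note h' = adjunct_in_Hom[OF A h]
  note h'f = Comp_in_Hom[OF f h']
  note \<epsilon> = counit_in_Hom[OF Hom_Obj(1)[OF g]] counit_in_Hom[OF Hom_Obj(2)[OF g]]
  show "adjunct A' B' (g \<cdot> h \<cdot> f) \<in> Hom C A' (S \<otimes> B')"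
    using adjunct_in_Hom[OF A' ghf] .
  show "(Id C S \<odot> g) \<cdot> adjunct A B h \<cdot> f \<in> Hom C A' (S \<otimes> B')"
    using Comp_in_Hom[OF h'f S_TensA_in_Hom[OF g]] .
  have "counit B' \<cdot> ((Id C S \<odot> g) \<cdot> adjunct A B h \<cdot> f)
      = (counit B' \<cdot> (Id C S \<odot> g)) \<cdot> adjunct A B h \<cdot> f"
    using Comp_assoc[OF h'f S_TensA_in_Hom[OF g] \<epsilon>(2)] by simp
  also have "\<dots> = g \<cdot> counit B \<cdot> adjunct A B h \<cdot> f"
    unfolding counit_natural[OF g] using Comp_assoc[OF h'f \<epsilon>(1) g] .
  also have "\<dots> = g \<cdot> h \<cdot> f"
    using Comp_assoc[OF f h' \<epsilon>(1)] counit_adjunct[OF A h] by simp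
  finally show "counit B' \<cdot> adjunct A' B' (g \<cdot> h \<cdot> f)
      = counit B' \<cdot> ((Id C S \<odot> g) \<cdot> adjunct A B h \<cdot> f)"
    using counit_adjunct[OF A' ghf] by simp
qed

lemma inclusion_functor: "cat_functor R C (\<lambda>A. A) (\<lambda>f. f)"
proof -
  interpret R: category R
    by (rule category_restriction)
  show ?thesis
    by unfold_locales (auto simp: Obj_restriction Hom_restriction restriction_simps(4,5))
qed

lemma coreflector_functor: "cat_functor C R (\<lambda>A. S \<otimes> A) (\<lambda>f. Id C S \<odot> f)"
proof -
  interpret R: category R
    by (rule category_restriction)
  show ?thesis
  proof
    show "S \<otimes> A \<in> Obj R" if "A \<in> Obj C" for A
      using that TensO_in_restriction S_in_restriction by blast
    then show "Id C S \<odot> f \<in> Hom R (S \<otimes> A) (S \<otimes> B)" if "f \<in> Hom C A B" for f A B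
      using that S_TensA_in_Hom Hom_Obj by (simp add: Hom_restriction)
  qed (use TensA_Id Id_TensA_Comp S_in_Obj in \<open>auto simp: restriction_simps(4,5)\<close>)
qed

lemma right_adjoint_restriction:
  "right_adjoint R C (\<lambda>A. A) (\<lambda>f. f) (\<lambda>A. S \<otimes> A) (\<lambda>f. Id C S \<odot> f)"
  unfolding right_adjoint_def
proof (intro conjI inclusion_functor coreflector_functor exI[of _ adjunct] ballI)
  fix A B assume "A \<in> Obj R" "B \<in> Obj C"
  then show "bij_betw (adjunct A B) (Hom C A B) (Hom R A (S \<otimes> B))"
    by (rule adjunct_bij)
next
  fix A A' B B' f g h
  assume "A \<in> Obj R" "A' \<in> Obj R" "f \<in> Hom R A' A" "g \<in> Hom C B B'" "h \<in> Hom C A B"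
  then show "adjunct A' B' (g \<cdot> h \<cdot> f) = (Id C S \<odot> g) \<cdot>\<^bsub>R\<^esub> adjunct A B h \<cdot>\<^bsub>R\<^esub> f"
    using adjunct_natural by (simp add: Hom_restriction restriction_simps(5))
qed

end

theorem proposition4p5:
  fixes C :: "('o, 'a, 'z) braided_cat_scheme" (structure)
    and \<sigma> :: "'a set" and s :: 'a and S :: 'o
  assumes "braided_monoidal_category C"
    and "subunit C \<sigma>"
    and "s \<in> \<sigma>"
    and "S = Dom C s"
  shows "monoidal_subcategory (restriction C s) C \<and>
    right_adjoint (restriction C s) C (\<lambda>A. A) (\<lambda>f. f) (\<lambda>A. S \<otimes> A) (\<lambda>f. Id C S \<odot> f)"
proof -
  interpret braided_monoidal_category C
    by (rule assms(1))
  interpret subunit_arrow C s S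
    using subunit_representative[OF assms(2,3)] assms(4) by unfold_locales simp_all
  show ?thesis
    using monoidal_subcategory_restriction right_adjoint_restriction by blast
qed

end
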